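(* Let $f(x)=\sum_{k=0}^\infty a_k\tau_k(x;0)$, $f\not\equiv0$, be an entire function of order $\sigma<\frac12$. Then $$\sigma_{\mu_{\mathrm W}(\cdot;f)}=\limsup_{n\to\infty}\frac{n\ln n}{-\ln|a_n|}.$$ Moreover, if $\sigma<\frac13$, then $\sigma=\limsup_{n\to\infty}\dfrac{n\ln n}{-\ln|a_n|}$.
   Context: The order of an entire function $f$ is $\sigma=\limsup_{r\to\infty}\frac{\ln^+\ln^+M(r;f)}{\ln r}$, where $M(r;f)=\max_{|x|=r}|f(x)|$ and $\ln^+t=\max\{\ln t,0\}$ (with $\ln^+0=0$). The Wilson basis at $0$ is $\tau_0(x;0)=1$ and $\tau_k(x;0)=\prod_{j=0}^{k-1}(-j^2-x)$ for $k\ge1$. Every entire function $f$ of order smaller than $\frac12$ has a unique expansion $f(x)=\sum_{k=0}^\infty a_k\tau_k(x;0)$ converging uniformly on compact subsets of $\mathbb{C}$; the $a_k$ are the coefficients of this expansion. For such $f\not\equiv0$ and $r>0$, the Wilson maximal term is $\mu_{\mathrm W}(r;f)=\max_{n\ge0}|a_n|\,r(r+1^2)\cdots(r+(n-1)^2)$ (the empty product is $1$), and its order is $\sigma_{\mu_{\mathrm W}(\cdot;f)}=\limsup_{r\to\infty}\frac{\ln^+\ln^+\mu_{\mathrm W}(r;f)}{\ln r}$. The quotient $\frac{n\ln n}{-\ln|a_n|}$ is interpreted as $0$ when $a_n=0$. *)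

theory Defs
  imports "HOL-Complex_Analysis.Complex_Analysis"
begin

text \<open>Growth orders are extended reals, so that the limits superior always exist.\<close>

definition ln_plus :: "real \<Rightarrow> real" where
  "ln_plus t = (if t \<le> 0 then 0 else max (ln t) 0)"

definition growth_order :: "(real \<Rightarrow> real) \<Rightarrow> ereal" where
  "growth_order \<phi> = Limsup at_top (\<lambda>r. ereal (ln_plus (ln_plus (\<phi> r)) / ln r))"

text \<open>
  The maxima in the next definition and in that of the Wilson maximal term are written as real
  suprema; the lemmas \<open>max_modulus_attained\<close> and \<open>wilson_max_term_attained\<close> show that
  they are attained.
\<close>

definition max_modulus :: "(complex \<Rightarrow> complex) \<Rightarrow> real \<Rightarrow> real" where
  "max_modulus f r = (SUP x\<in>sphere 0 r. norm (f x))"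

definition entire_order :: "(complex \<Rightarrow> complex) \<Rightarrow> ereal" where
  "entire_order f = growth_order (max_modulus f)"

definition wilson_basis :: "nat \<Rightarrow> complex \<Rightarrow> complex" where
  "wilson_basis k x = (\<Prod>j<k. - (of_nat j)\<^sup>2 - x)"

definition wilson_expansion :: "(complex \<Rightarrow> complex) \<Rightarrow> (nat \<Rightarrow> complex) \<Rightarrow> bool" where
  "wilson_expansion f a \<longleftrightarrow>
     (\<forall>K. compact K \<longrightarrow>
        uniform_limit K (\<lambda>n x. \<Sum>k<n. a k * wilson_basis k x) f sequentially)"

text \<open>
  The maximal term of \<open>f\<close> depends on \<open>f\<close> only through its coefficients in the Wilson basis,
  which are the argument here.
\<close>

definition wilson_max_term :: "(nat \<Rightarrow> complex) \<Rightarrow> real \<Rightarrow> real" where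
  "wilson_max_term a r = (SUP n. norm (a n) * (\<Prod>j<n. r + (real j)\<^sup>2))"

definition coeff_quotient :: "(nat \<Rightarrow> complex) \<Rightarrow> nat \<Rightarrow> real" where
  "coeff_quotient a n =
     (if a n = 0 then 0 else real n * ln (real n) / (- ln (norm (a n))))"

lemma max_modulus_attained:
  assumes "f holomorphic_on UNIV" "r \<ge> 0"
  shows "\<exists>x\<in>sphere 0 r. max_modulus f r = norm (f x) \<and> (\<forall>y\<in>sphere 0 r. norm (f y) \<le> norm (f x))"
proof -
  have c: "continuous_on (sphere 0 r) (\<lambda>x. norm (f x))"
    using assms(1) by (intro continuous_intros holomorphic_on_imp_continuous_on)
      (auto intro: holomorphic_on_subset)
  have "complex_of_real r \<in> sphere 0 r" using assms(2) by simp
  then have "sphere (0::complex) r \<noteq> {}" by blast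
  from continuous_attains_sup[OF compact_sphere this c]
  obtain x where x: "x \<in> sphere 0 r" "\<And>y. y \<in> sphere 0 r \<Longrightarrow> norm (f y) \<le> norm (f x)" by blast
  have "max_modulus f r = norm (f x)"
    unfolding max_modulus_def using x by (intro cSup_eq_maximum) auto
  with x show ?thesis by blast
qed

lemma norm_wilson_basis_of_real:
  assumes "r \<ge> 0"
  shows "norm (wilson_basis n (complex_of_real r)) = (\<Prod>j<n. r + (real j)\<^sup>2)"
proof -
  have "norm (- (of_nat j)\<^sup>2 - complex_of_real r) = r + (real j)\<^sup>2" for j
  proof -
    have "- (of_nat j)\<^sup>2 - complex_of_real r = complex_of_real (- (r + (real j)\<^sup>2))" by simp
    then show ?thesis using assms zero_le_power2[of "real j"]
      by (simp only: norm_of_real abs_minus_cancel abs_of_nonneg add_nonneg_nonneg)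
  qed
  then show ?thesis by (simp add: wilson_basis_def prod_norm [symmetric])
qed

lemma wilson_max_term_attained:
  assumes "wilson_expansion f a" "r \<ge> 0"
  defines "t \<equiv> \<lambda>n. norm (a n) * (\<Prod>j<n. r + (real j)\<^sup>2)"
  shows "\<exists>n. wilson_max_term a r = t n \<and> (\<forall>m. t m \<le> t n)"
proof -
  have "uniform_limit {complex_of_real r} (\<lambda>n x. \<Sum>k<n. a k * wilson_basis k x) f sequentially"
    using assms(1) compact_sing unfolding wilson_expansion_def by blast
  then have "(\<lambda>k. a k * wilson_basis k (of_real r)) sums f (of_real r)"
    unfolding sums_def uniform_limit_singleton .
  then have "(\<lambda>k. a k * wilson_basis k (of_real r)) \<longlonglongrightarrow> 0"
    by (intro summable_LIMSEQ_zero sums_summable)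
  then have "(\<lambda>k. norm (a k * wilson_basis k (of_real r))) \<longlonglongrightarrow> 0"
    by (rule tendsto_norm_zero)
  then have lim: "t \<longlonglongrightarrow> 0"
    by (simp add: t_def norm_mult norm_wilson_basis_of_real[OF assms(2)])
  have nonneg: "t m \<ge> 0" for m
    using assms(2) by (auto simp: t_def intro!: mult_nonneg_nonneg prod_nonneg)
  have "\<exists>n. \<forall>m. t m \<le> t n"
  proof (cases "\<forall>m. t m = 0")
    case False
    then obtain k where k: "t k > 0" using nonneg by (metis less_eq_real_def)
    from order_tendstoD(2)[OF lim k] obtain N where N: "\<And>m. m \<ge> N \<Longrightarrow> t m < t k"
      by (auto simp: eventually_sequentially)
    have "Max (t ` {..max N k}) \<in> t ` {..max N k}" by (intro Max_in) auto
    then obtain n where n: "t n = Max (t ` {..max N k})" by (metis imageE)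
    have le: "t m \<le> t n" if "m \<le> max N k" for m
      unfolding n using that by (intro Max_ge) auto
    have "t m \<le> t n" for m
      using le[of m] le[of k] N[of m] by (cases "m \<le> max N k") (simp, linarith)
    then show ?thesis by blast
  qed auto
  then obtain n where n: "\<And>m. t m \<le> t n" by blast
  have "wilson_max_term a r = t n"
    unfolding wilson_max_term_def t_def[symmetric] using n
    by (intro cSup_eq_maximum) (auto simp: t_def)
  with n show ?thesis by blast
qed

end

theory Submission
  imports Defs "HOL-Real_Asymp.Real_Asymp"
begin

text \<open>
  Write \<open>\<sigma>\<close> for the order of \<open>f\<close>, \<open>\<sigma>\<^sub>\<mu>\<close> for the order of the maximal term and \<open>\<chi>\<close> for the limit
  superior of the quotients. Roughly, \<open>\<chi> \<le> s\<close> means that \<open>|a\<^sub>n| \<le> (K n\<^bsup>-1/s\<^esup>)\<^sup>n\<close> for large \<open>n\<close>. As long as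
  \<open>\<sigma> < 1/2\<close>, all three numbers agree, because growth bounds of the form \<open>exp (r\<^sup>s)\<close> and coefficient
  bounds of this form imply each other.

  From growth to coefficients, one evaluates at the radius \<open>R = n\<^bsup>1/s\<^esup>\<close>, where the growth bound
  \<open>exp (R\<^sup>s)\<close> is only \<open>e\<^sup>n\<close>. For the maximal term, \<open>|a\<^sub>n| R\<^sup>n \<le> \<mu>(R)\<close> gives the claim at once
  (\<open>limsup_coeff_quotient_le_max_term_order\<close>). For \<open>f\<close> itself, the \<open>a\<^sub>n\<close> are, up to sign, the
  divided differences of \<open>f\<close> at the nodes \<open>0, -1, -4, \<dots>, -n\<^sup>2\<close>. Since \<open>s < 1/2\<close>, the radius \<open>R\<close> is
  far larger than \<open>n\<^sup>2\<close>, so all these nodes lie in the disc of radius \<open>R/2\<close>, and Newton interpolation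
  yields a Cauchy estimate \<open>|a\<^sub>n| \<le> M(R) (4/R)\<^sup>n\<close> (\<open>newton_coeff_bound\<close>, \<open>norm_wilson_coeff_le\<close>).
  Hence \<open>\<chi> \<le> \<sigma>\<^sub>\<mu>\<close> and \<open>\<chi> \<le> \<sigma>\<close>; in particular \<open>\<chi> < 1/2\<close>.

  From coefficients to growth, both \<open>M(r)\<close> and \<open>\<mu>(r)\<close> are at most
  \<open>\<Sum>\<^sub>n |a\<^sub>n| r (r + 1\<^sup>2) \<dots> (r + (n-1)\<^sup>2)\<close>. If \<open>\<chi> < c < 1/2\<close>, then for large \<open>n\<close> the \<open>n\<close>-th term is at most
  \<open>(n\<^bsup>-1/c\<^esup> r + n\<^bsup>2-1/c\<^esup>)\<^sup>n\<close>, which is below \<open>2\<^bsup>-n\<^esup>\<close> as soon as \<open>n \<ge> (4r)\<^sup>c\<close>: here \<open>c < 1/2\<close> makes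
  the second exponent negative. The remaining terms, about \<open>(4r)\<^sup>c\<close> in number, satisfy
  \<open>n\<^sup>2 \<le> 4r\<close> and are crudely bounded, up to a constant, by the power of \<open>5r\<close> with exponent \<open>(4r)\<^sup>c\<close>. So the sum is
  \<open>exp (O(r\<^sup>c ln r))\<close> (\<open>eventually_wilson_sum_le\<close>), whence \<open>\<sigma> \<le> \<chi>\<close> and \<open>\<sigma>\<^sub>\<mu> \<le> \<chi>\<close>.
\<close>

section \<open>Growth orders and exponential bounds\<close>

lemma ln_plus_nonneg: "0 \<le> ln_plus t"
  by (simp add: ln_plus_def)

lemma ln_plus_le_iff: "0 \<le> y \<Longrightarrow> ln_plus t \<le> y \<longleftrightarrow> t \<le> exp y"
proof (cases "0 < t")
  case True
  assume "0 \<le> y"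
  moreover have "ln t \<le> y \<longleftrightarrow> t \<le> exp y"
    using True by (metis exp_le_cancel_iff exp_ln)
  ultimately show ?thesis
    using True by (simp add: ln_plus_def)
next
  case False
  then have "t \<le> exp y"
    by (intro order_trans[OF _ exp_ge_zero]) simp
  moreover assume "0 \<le> y"
  ultimately show ?thesis
    using False by (simp add: ln_plus_def)
qed

lemma growth_order_nonneg: "0 \<le> growth_order \<phi>"
proof -
  have "0 = Limsup at_top (\<lambda>r::real. 0 :: ereal)"
    by (simp add: Limsup_const)
  also have "\<dots> \<le> growth_order \<phi>"
    unfolding growth_order_def
    by (intro Limsup_mono eventually_mono[OF eventually_gt_at_top[of 1]])
      (simp add: ln_plus_nonneg zero_ereal_def)
  finally show ?thesis .
qed

lemma growth_order_le:
  assumes "0 < s" "eventually (\<lambda>r. \<phi> r \<le> exp (r powr s)) at_top"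
  shows "growth_order \<phi> \<le> ereal s"
  unfolding growth_order_def
proof (rule Limsup_bounded)
  show "eventually (\<lambda>r. ereal (ln_plus (ln_plus (\<phi> r)) / ln r) \<le> ereal s) at_top"
    using assms(2) eventually_gt_at_top[of 1]
  proof eventually_elim
    case (elim r)
    have "ln_plus (\<phi> r) \<le> r powr s"
      using elim by (simp add: ln_plus_le_iff)
    also have "\<dots> = exp (s * ln r)"
      using elim by (simp add: powr_def)
    finally have "ln_plus (ln_plus (\<phi> r)) \<le> s * ln r"
      using elim assms(1) by (simp add: ln_plus_le_iff)
    then show ?case
      using elim by (simp add: field_simps)
  qed
qed

lemma growth_order_lessD:
  assumes "growth_order \<phi> < ereal s"
  shows "eventually (\<lambda>r. \<phi> r \<le> exp (r powr s)) at_top"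
  using Limsup_lessD[OF assms[unfolded growth_order_def]] eventually_gt_at_top[of 1]
proof eventually_elim
  case (elim r)
  have "ln_plus (ln_plus (\<phi> r)) \<le> s * ln r"
    using elim by (simp add: field_simps)
  then have "ln_plus (\<phi> r) \<le> exp (s * ln r)"
    using ln_plus_nonneg[of "ln_plus (\<phi> r)"] ln_plus_le_iff order_trans by blast
  also have "\<dots> = r powr s"
    using elim by (simp add: powr_def)
  finally show ?case
    by (simp add: ln_plus_le_iff)
qed

section \<open>Decay of the coefficients and the quotients\<close>

text \<open>
  At the point 1 every basis polynomial has modulus at least 1, so convergence of the expansion at
  this single point suffices. Consequently \<open>|a\<^sub>n| < 1\<close> for large \<open>n\<close>, and the finitely many
  quotients with \<open>|a\<^sub>n| \<ge> 1\<close>, whose sign carries no information, do not affect the limit superior.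
\<close>

lemma coeff_tendsto_zero:
  assumes "wilson_expansion f a"
  shows "a \<longlonglongrightarrow> 0"
proof -
  have "uniform_limit {1} (\<lambda>n x. \<Sum>k<n. a k * wilson_basis k x) f sequentially"
    using assms compact_sing unfolding wilson_expansion_def by blast
  then have "(\<lambda>k. a k * wilson_basis k 1) sums f 1"
    unfolding sums_def uniform_limit_singleton .
  then have lim: "(\<lambda>k. a k * wilson_basis k 1) \<longlonglongrightarrow> 0"
    by (intro summable_LIMSEQ_zero sums_summable)
  have "1 \<le> norm (wilson_basis k 1)" for k
    using norm_wilson_basis_of_real[of 1 k] by (simp add: prod_ge_1)
  then have "norm (a k) \<le> norm (a k * wilson_basis k 1)" for k
    by (simp add: norm_mult mult_le_cancel_left1)
  with lim show ?thesis
    by (intro Lim_null_comparison[OF _ tendsto_norm_zero[OF lim]]) auto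
qed

lemma eventually_norm_coeff_less_1:
  assumes "wilson_expansion f a"
  shows "eventually (\<lambda>n. norm (a n) < 1) sequentially"
  using order_tendstoD(2)[OF tendsto_norm_zero[OF coeff_tendsto_zero[OF assms]], of 1] by simp

lemma limsup_coeff_quotient_nonneg:
  assumes "wilson_expansion f a"
  shows "0 \<le> limsup (\<lambda>n. ereal (coeff_quotient a n))"
proof -
  have "eventually (\<lambda>n. 0 \<le> ereal (coeff_quotient a n)) sequentially"
    using eventually_norm_coeff_less_1[OF assms] eventually_ge_at_top[of 1]
    by eventually_elim (auto simp: coeff_quotient_def divide_nonneg_nonpos)
  then have "limsup (\<lambda>n. 0) \<le> limsup (\<lambda>n. ereal (coeff_quotient a n))"
    by (rule Limsup_mono)
  then show ?thesis
    by (simp add: Limsup_const)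
qed

text \<open>
  Taking logarithms turns the bound into \<open>- ln |a\<^sub>n| \<ge> n (ln n / s - ln K)\<close>, and the constant
  \<open>ln K\<close> is negligible against \<open>ln n\<close>: geometric factors in coefficient bounds are harmless.
\<close>

lemma limsup_coeff_quotient_le:
  assumes "0 < s" "0 < K"
    and bound: "eventually (\<lambda>n. norm (a n) \<le> (K * real n powr (- 1 / s)) ^ n) sequentially"
  shows "limsup (\<lambda>n. ereal (coeff_quotient a n)) \<le> ereal s"
proof -
  define g where "g n = ln (real n) / (ln (real n) / s - ln K)" for n
  have pos: "eventually (\<lambda>n. 0 < ln (real n) / s - ln K) sequentially"
    using assms(1) by real_asymp
  have lim: "g \<longlonglongrightarrow> s"
    unfolding g_def using assms(1) by real_asymp
  have "eventually (\<lambda>n. ereal (coeff_quotient a n) \<le> ereal (g n)) sequentially"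
    using bound pos eventually_gt_at_top[of 1]
  proof eventually_elim
    case (elim n)
    show ?case
    proof (cases "a n = 0")
      case True
      then show ?thesis
        using elim by (simp add: coeff_quotient_def g_def)
    next
      case False
      have "ln (norm (a n)) \<le> ln ((K * real n powr (- 1 / s)) ^ n)"
        using elim False assms by (subst ln_le_cancel_iff) auto
      also have "\<dots> = - (real n * (ln (real n) / s - ln K))"
        using elim assms by (simp add: ln_realpow ln_mult ln_powr algebra_simps)
      finally have "real n * (ln (real n) / s - ln K) \<le> - ln (norm (a n))"
        by simp
      moreover have "0 < real n * (ln (real n) / s - ln K)"
        using elim by simp
      ultimately have "real n * ln (real n) / (- ln (norm (a n)))
          \<le> real n * ln (real n) / (real n * (ln (real n) / s - ln K))"
        using elim by (intro frac_le) auto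
      then show ?thesis
        using False elim by (simp add: coeff_quotient_def g_def)
    qed
  qed
  then have "limsup (\<lambda>n. ereal (coeff_quotient a n)) \<le> limsup (\<lambda>n. ereal (g n))"
    by (rule Limsup_mono)
  also have "\<dots> = ereal s"
    using lim by (intro lim_imp_Limsup) auto
  finally show ?thesis .
qed

lemma limsup_coeff_quotient_lessD:
  assumes "wilson_expansion f a" "0 < c" "limsup (\<lambda>n. ereal (coeff_quotient a n)) < ereal c"
  shows "eventually (\<lambda>n. norm (a n) \<le> (real n powr (- 1 / c)) ^ n) sequentially"
  using Limsup_lessD[OF assms(3)] eventually_norm_coeff_less_1[OF assms(1)]
    eventually_gt_at_top[of 1]
proof eventually_elim
  case (elim n)
  show ?case
  proof (cases "a n = 0")
    case False
    then have "real n * ln (real n) \<le> c * (- ln (norm (a n)))"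
      using elim by (simp add: coeff_quotient_def field_simps)
    then have "ln (norm (a n)) \<le> real n * (- 1 / c * ln (real n))"
      using assms(2) by (simp add: field_simps)
    also have "\<dots> = ln ((real n powr (- 1 / c)) ^ n)"
      using elim by (simp add: ln_realpow ln_powr)
    finally show ?thesis
      using False elim by (subst (asm) ln_le_cancel_iff) auto
  qed auto
qed

section \<open>Newton interpolation\<close>

text \<open>
  The hypothesis on the values \<open>f (c m)\<close> says that the \<open>a k\<close> are the coefficients of the Newton
  interpolation of \<open>f\<close> at the nodes \<open>c 0, c 1, \<dots>\<close>. Splitting off the first node,
  \<open>f z = a 0 + (c 0 - z) h z\<close> with \<open>h\<close> entire, the shifted sequence consists of the Newton coefficients
  of \<open>h\<close> at the remaining nodes. On the circle of radius \<open>R\<close> the function \<open>h\<close> is bounded by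
  \<open>2 B / (R - |c 0|)\<close>, because \<open>|f (c 0)| \<le> B\<close> by the maximum principle. So each division costs one
  factor of the product. A contour integral would avoid the factors 2, but these are only geometric.
\<close>

lemma newton_coeff_bound:
  fixes f :: "complex \<Rightarrow> complex" and c a :: "nat \<Rightarrow> complex"
  assumes "f holomorphic_on UNIV"
    and "\<And>j. j \<le> n \<Longrightarrow> norm (c j) < R"
    and "inj_on c {..n}"
    and "\<And>m. m \<le> n \<Longrightarrow> f (c m) = (\<Sum>k\<le>m. a k * (\<Prod>j<k. c j - c m))"
    and "\<And>z. norm z = R \<Longrightarrow> norm (f z) \<le> B"
  shows "norm (a n) \<le> B * (\<Prod>j<n. 2 / (R - norm (c j)))"
  using assms
proof (induction n arbitrary: f a c B)
  case 0
  have "norm (f (c 0)) \<le> B"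
    by (rule maximum_modulus_frontier[of f "cball 0 R"])
      (use 0 in \<open>auto intro: holomorphic_on_subset holomorphic_on_imp_continuous_on
        order.strict_implies_order\<close>)
  then show ?case
    using "0.prems"(4)[of 0] by simp
next
  case (Suc n)
  have c0: "norm (c 0) < R"
    using Suc.prems(2) by simp
  have fc0: "f (c 0) = a 0"
    using Suc.prems(4)[of 0] by simp
  have max: "norm (f (c 0)) \<le> B"
    by (rule maximum_modulus_frontier[of f "cball 0 R"])
      (use Suc.prems(1,5) c0 in \<open>auto intro: holomorphic_on_subset
        holomorphic_on_imp_continuous_on order.strict_implies_order\<close>)
  define h where "h = (\<lambda>z. - (if z = c 0 then deriv f (c 0) else (f z - f (c 0)) / (z - c 0)))"
  have h: "(c 0 - z) * h z = f z - a 0" if "z \<noteq> c 0" for z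
    using that by (simp add: h_def fc0 field_simps)
  have "norm (a (Suc n))
      \<le> (2 * B / (R - norm (c 0))) * (\<Prod>j<n. 2 / (R - norm (c (Suc j))))"
  proof (rule Suc.IH[of h "\<lambda>j. c (Suc j)" "\<lambda>k. a (Suc k)"])
    show "h holomorphic_on UNIV"
      unfolding h_def using Suc.prems(1) by (intro holomorphic_on_minus pole_lemma) auto
    show "norm (c (Suc j)) < R" if "j \<le> n" for j
      using Suc.prems(2) that by simp
    show "inj_on (\<lambda>j. c (Suc j)) {..n}"
      using Suc.prems(3) by (auto simp: inj_on_def)
    show "h (c (Suc m)) = (\<Sum>k\<le>m. a (Suc k) * (\<Prod>j<k. c (Suc j) - c (Suc m)))"
      if "m \<le> n" for m
    proof -
      have ne: "c (Suc m) \<noteq> c 0"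
        using inj_onD[OF Suc.prems(3), of "Suc m" 0] that by auto
      have "(c 0 - c (Suc m)) * h (c (Suc m)) = f (c (Suc m)) - a 0"
        using h ne by blast
      also have "\<dots> = (\<Sum>k\<le>m. a (Suc k) * (\<Prod>j<Suc k. c j - c (Suc m)))"
        using Suc.prems(4)[of "Suc m"] that
        by (simp add: sum.atMost_Suc_shift del: prod.lessThan_Suc sum.atMost_Suc)
      also have "\<dots> = (c 0 - c (Suc m))
          * (\<Sum>k\<le>m. a (Suc k) * (\<Prod>j<k. c (Suc j) - c (Suc m)))"
        by (simp add: prod.lessThan_Suc_shift sum_distrib_left mult_ac del: prod.lessThan_Suc)
      finally show ?thesis
        using ne by simp
    qed
    show "norm (h z) \<le> 2 * B / (R - norm (c 0))" if "norm z = R" for z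
    proof -
      have "z \<noteq> c 0"
        using that c0 by auto
      then have "norm (h z) = norm (f z - f (c 0)) / norm (z - c 0)"
        by (simp add: h_def norm_divide)
      also have "\<dots> \<le> (2 * B) / (R - norm (c 0))"
      proof (rule frac_le)
        show "norm (f z - f (c 0)) \<le> 2 * B"
          using norm_triangle_ineq4[of "f z" "f (c 0)"] max Suc.prems(5)[OF that] by simp
        then show "0 \<le> 2 * B"
          by (rule order_trans[OF norm_ge_zero])
        show "R - norm (c 0) \<le> norm (z - c 0)"
          using norm_triangle_ineq2[of z "c 0"] that by simp
      qed (use c0 in simp)
      finally show ?thesis .
    qed
  qed
  then show ?case
    by (simp add: prod.lessThan_Suc_shift mult_ac del: prod.lessThan_Suc)
qed

text \<open>
  At a node the expansion terminates, so the coefficients of a Wilson expansion are Newton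
  coefficients in the sense of the preceding lemma.
\<close>

lemma wilson_expansion_at_node:
  assumes "wilson_expansion f a"
  shows "f (- (of_nat m)\<^sup>2)
    = (\<Sum>k\<le>m. a k * (\<Prod>j<k. - (of_nat j)\<^sup>2 - (- (of_nat m)\<^sup>2)))"
proof -
  define x :: complex where "x = - (of_nat m)\<^sup>2"
  have "uniform_limit {x} (\<lambda>n x. \<Sum>k<n. a k * wilson_basis k x) f sequentially"
    using assms compact_sing unfolding wilson_expansion_def by blast
  then have 1: "(\<lambda>k. a k * wilson_basis k x) sums f x"
    unfolding sums_def uniform_limit_singleton .
  have "wilson_basis k x = 0" if "k \<notin> {..m}" for k
    using that by (auto simp: wilson_basis_def x_def intro!: bexI[of _ m])
  then have "(\<lambda>k. a k * wilson_basis k x) sums (\<Sum>k\<le>m. a k * wilson_basis k x)"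
    by (intro sums_finite) auto
  from sums_unique2[OF 1 this] show ?thesis
    by (simp add: wilson_basis_def x_def)
qed

lemma norm_le_max_modulus:
  assumes "f holomorphic_on UNIV" "norm z = r"
  shows "norm (f z) \<le> max_modulus f r"
  using max_modulus_attained[OF assms(1), of r] assms(2) by force

text \<open>
  A Cauchy estimate for Wilson coefficients: the condition on \<open>R\<close> keeps all nodes in the disc of
  radius \<open>R / 2\<close>.
\<close>

lemma norm_wilson_coeff_le:
  assumes "f holomorphic_on UNIV" "wilson_expansion f a" "(real n)\<^sup>2 \<le> R / 2" "0 < R"
  shows "norm (a n) \<le> max_modulus f R * (4 / R) ^ n"
proof -
  have sq: "(real j)\<^sup>2 \<le> R / 2" if "j \<le> n" for j
    using power_mono[of "real j" "real n" 2] that assms(3) by linarith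
  have norm_node: "norm (- (of_nat j)\<^sup>2 :: complex) = (real j)\<^sup>2" for j
    by (simp add: norm_power)
  have "norm (a n) \<le> max_modulus f R
      * (\<Prod>j<n. 2 / (R - norm (- (of_nat j)\<^sup>2 :: complex)))"
  proof (rule newton_coeff_bound[OF assms(1)])
    show "norm (- (of_nat j)\<^sup>2 :: complex) < R" if "j \<le> n" for j
      using sq[OF that] assms(4) unfolding norm_node by simp
    have "j = i" if "(of_nat j :: complex)\<^sup>2 = (of_nat i)\<^sup>2" for i j
    proof -
      have "of_nat (j\<^sup>2) = (of_nat (i\<^sup>2) :: complex)"
        using that by simp
      then show ?thesis
        by (simp only: of_nat_eq_iff) simp
    qed
    then show "inj_on (\<lambda>j. - (of_nat j)\<^sup>2 :: complex) {..n}"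
      by (auto simp: inj_on_def)
  qed (use wilson_expansion_at_node[OF assms(2)] norm_le_max_modulus[OF assms(1)] in auto)
  also have "\<dots> \<le> max_modulus f R * (\<Prod>j<n. 4 / R)"
  proof (intro mult_left_mono prod_mono conjI)
    fix j assume "j \<in> {..<n}"
    then have j: "(real j)\<^sup>2 \<le> R / 2"
      by (intro sq) auto
    have "2 / (R - (real j)\<^sup>2) \<le> 2 / (R / 2)"
      using j assms(4) by (intro divide_left_mono mult_pos_pos) auto
    then show "2 / (R - norm (- (of_nat j)\<^sup>2 :: complex)) \<le> 4 / R"
      unfolding norm_node by simp
    show "0 \<le> 2 / (R - norm (- (of_nat j)\<^sup>2 :: complex))"
      unfolding norm_node using j assms(4) by simp
  next
    show "0 \<le> max_modulus f R"
      using norm_le_max_modulus[OF assms(1), of "of_real R" R] assms(4)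
      by (intro order_trans[OF norm_ge_zero]) auto
  qed
  finally show ?thesis
    by simp
qed

section \<open>The quotients are bounded by the growth orders\<close>

lemma limsup_coeff_quotient_le_entire_order:
  assumes "f holomorphic_on UNIV" "wilson_expansion f a" "entire_order f < ereal (1 / 2)"
  shows "limsup (\<lambda>n. ereal (coeff_quotient a n)) \<le> entire_order f"
proof (rule dense_ge_bounded[OF assms(3)])
  fix w assume w: "entire_order f < w" "w < ereal (1 / 2)"
  have "0 < w"
    using growth_order_nonneg[of "max_modulus f"] w(1) unfolding entire_order_def by simp
  then obtain s where s: "w = ereal s" "0 < s" "s < 1 / 2"
    using w(2) by (cases w) auto
  \<comment> \<open>This radius makes the growth bound \<open>exp (R\<^sup>s)\<close> equal to \<open>exp n\<close>, a geometric factor.\<close>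
  define R where "R n = real n powr (1 / s)" for n
  have R: "filterlim R at_top sequentially"
    unfolding R_def using s(2) by real_asymp
  have s2: "2 < 1 / s"
    using s by (simp add: field_simps)
  \<comment> \<open>This is where order below \<open>1/2\<close> enters: the radius outgrows the nodes.\<close>
  have half: "eventually (\<lambda>n. (real n)\<^sup>2 \<le> R n / 2) sequentially"
  proof -
    define d where "d = 1 / s - 2"
    have "0 < d" "1 / s = 2 + d"
      using s2 by (auto simp: d_def)
    then show ?thesis
      unfolding R_def by (simp only:) real_asymp
  qed
  have M: "eventually (\<lambda>n. max_modulus f (R n) \<le> exp (R n powr s)) sequentially"
    using eventually_compose_filterlim[OF growth_order_lessD R] w(1) s(1)
    unfolding entire_order_def by blast
  have "eventually (\<lambda>n. norm (a n) \<le> (4 * exp 1 * real n powr (- 1 / s)) ^ n) sequentially"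
    using half M eventually_gt_at_top[of 0]
  proof eventually_elim
    case (elim n)
    have Rpos: "0 < R n"
      using elim by (simp add: R_def)
    have "norm (a n) \<le> max_modulus f (R n) * (4 / R n) ^ n"
      by (rule norm_wilson_coeff_le[OF assms(1,2) elim(1) Rpos])
    also have "\<dots> \<le> exp (R n powr s) * (4 / R n) ^ n"
      using elim Rpos by (intro mult_right_mono) auto
    also have "R n powr s = real n"
      using elim s by (simp add: R_def powr_powr)
    also have "exp (real n) * (4 / R n) ^ n = (4 * exp 1 * real n powr (- 1 / s)) ^ n"
      by (simp add: R_def powr_minus_divide power_divide power_mult_distrib
          exp_of_nat_mult[of n 1, simplified])
    finally show ?case .
  qed
  then show "limsup (\<lambda>n. ereal (coeff_quotient a n)) \<le> w"
    unfolding s(1) using s(2) by (intro limsup_coeff_quotient_le) auto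
qed

lemma limsup_coeff_quotient_le_max_term_order:
  assumes "wilson_expansion f a"
  shows "limsup (\<lambda>n. ereal (coeff_quotient a n)) \<le> growth_order (wilson_max_term a)"
proof (rule dense_ge)
  fix w assume w: "growth_order (wilson_max_term a) < w"
  have "0 < w"
    using growth_order_nonneg w by (rule order.strict_trans1)
  show "limsup (\<lambda>n. ereal (coeff_quotient a n)) \<le> w"
  proof (cases w)
    case (real s)
    with \<open>0 < w\<close> have s: "0 < s"
      by simp
    define R where "R n = real n powr (1 / s)" for n
    have R: "filterlim R at_top sequentially"
      unfolding R_def using s by real_asymp
    have M: "eventually (\<lambda>n. wilson_max_term a (R n) \<le> exp (R n powr s)) sequentially"
      using eventually_compose_filterlim[OF growth_order_lessD R] w real by blast
    have "eventually (\<lambda>n. norm (a n) \<le> (exp 1 * real n powr (- 1 / s)) ^ n) sequentially"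
      using M eventually_gt_at_top[of 0]
    proof eventually_elim
      case (elim n)
      have Rpos: "0 < R n"
        using elim by (simp add: R_def)
      have "R n ^ n = (\<Prod>j<n. R n)"
        by simp
      also have "\<dots> \<le> (\<Prod>j<n. R n + (real j)\<^sup>2)"
        using Rpos by (intro prod_mono) auto
      finally have "norm (a n) * R n ^ n \<le> norm (a n) * (\<Prod>j<n. R n + (real j)\<^sup>2)"
        by (intro mult_left_mono) auto
      also have "\<dots> \<le> wilson_max_term a (R n)"
        using wilson_max_term_attained[OF assms, of "R n"] Rpos by auto
      also have "\<dots> \<le> exp (R n powr s)"
        by (rule elim)
      also have "R n powr s = real n"
        using elim s by (simp add: R_def powr_powr)
      finally have "norm (a n) \<le> exp (real n) / R n ^ n"
        using Rpos by (simp add: field_simps)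
      also have "\<dots> = (exp 1 * real n powr (- 1 / s)) ^ n"
        by (simp add: R_def powr_minus_divide power_divide power_mult_distrib
            exp_of_nat_mult[of n 1, simplified])
      finally show ?case .
    qed
    then show ?thesis
      unfolding real using s by (intro limsup_coeff_quotient_le) auto
  qed (use \<open>0 < w\<close> in auto)
qed

section \<open>The growth orders are bounded by the quotients\<close>

text \<open>
  The threshold \<open>n = (4 r)\<^sup>c\<close> separates two regimes. Beyond it, \<open>n\<^bsup>-1/c\<^esup> r \<le> 1/4\<close>, and for large \<open>n\<close>
  also \<open>n\<^bsup>-1/c\<^esup> n\<^sup>2 \<le> 1/4\<close>, so the decay of the coefficients beats the product by \<open>(1/2)\<^sup>n\<close>. Below it,
  \<open>n\<^sup>2 \<le> 4 r\<close> bounds every factor of the product by \<open>5 r\<close>, and only boundedness of the coefficients is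
  used.
\<close>

lemma eventually_wilson_term_le:
  assumes "wilson_expansion f a" "0 < c" "c < 1 / 2"
    and "limsup (\<lambda>n. ereal (coeff_quotient a n)) < ereal c"
  obtains A where "0 < A" "eventually (\<lambda>r. \<forall>n. norm (a n) * (\<Prod>j<n. r + (real j)\<^sup>2)
      \<le> (1 / 2) ^ n + (if real n < (4 * r) powr c then A * (5 * r) powr ((4 * r) powr c) else 0))
    at_top"
proof -
  have "Bseq a"
    using coeff_tendsto_zero[OF assms(1)] by (intro convergent_imp_Bseq convergentI)
  then obtain A where A: "0 < A" "\<And>n. norm (a n) \<le> A"
    by (auto elim: BseqE)
  have small: "eventually (\<lambda>n. real n powr (- 1 / c) * (real n)\<^sup>2 \<le> 1 / 4) sequentially"
  proof -
    define d where "d = 1 / c - 2"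
    have "2 < 1 / c"
      using assms by (simp add: field_simps)
    then have d: "0 < d" "- 1 / c = - 2 - d"
      by (auto simp: d_def)
    show ?thesis
      unfolding d(2) using d(1) by real_asymp
  qed
  obtain N where N: "0 < N"
      "\<And>n. N \<le> n \<Longrightarrow> norm (a n) \<le> (real n powr (- 1 / c)) ^ n"
      "\<And>n. N \<le> n \<Longrightarrow> real n powr (- 1 / c) * (real n)\<^sup>2 \<le> 1 / 4"
    using eventually_conj[OF eventually_conj[OF
        limsup_coeff_quotient_lessD[OF assms(1,2,4)] small] eventually_gt_at_top[of 0]]
    unfolding eventually_sequentially by (metis order_refl)
  \<comment> \<open>For such \<open>r\<close>, all \<open>n\<close> beyond the threshold are at least \<open>N\<close>.\<close>
  have big: "eventually (\<lambda>r::real. real N \<le> (4 * r) powr c) at_top"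
    using assms(2) by real_asymp
  have "eventually (\<lambda>r. \<forall>n. norm (a n) * (\<Prod>j<n. r + (real j)\<^sup>2)
      \<le> (1 / 2) ^ n + (if real n < (4 * r) powr c then A * (5 * r) powr ((4 * r) powr c) else 0))
    at_top"
    using big eventually_gt_at_top[of 1]
  proof eventually_elim
    case (elim r)
    show ?case
    proof
      fix n
      have "(\<Prod>j<n. r + (real j)\<^sup>2) \<le> (\<Prod>j<n. r + (real n)\<^sup>2)"
        using elim by (intro prod_mono) (auto intro!: power_mono)
      then have prod: "(\<Prod>j<n. r + (real j)\<^sup>2) \<le> (r + (real n)\<^sup>2) ^ n"
        by simp
      show "norm (a n) * (\<Prod>j<n. r + (real j)\<^sup>2)
        \<le> (1 / 2) ^ n + (if real n < (4 * r) powr c then A * (5 * r) powr ((4 * r) powr c) else 0)"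
      proof (cases "real n < (4 * r) powr c")
        case True
        have "(real n)\<^sup>2 \<le> ((4 * r) powr c)\<^sup>2"
          using True by (intro power_mono) auto
        also have "\<dots> = (4 * r) powr (2 * c)"
          by (simp add: power2_eq_square flip: powr_add)
        also have "\<dots> \<le> (4 * r) powr 1"
          using elim assms by (intro powr_mono) auto
        finally have "r + (real n)\<^sup>2 \<le> 5 * r"
          using elim by simp
        then have "(r + (real n)\<^sup>2) ^ n \<le> (5 * r) ^ n"
          using elim by (intro power_mono) auto
        also have "\<dots> = (5 * r) powr real n"
          using elim by (simp add: powr_realpow)
        also have "\<dots> \<le> (5 * r) powr ((4 * r) powr c)"
          using elim True by (intro powr_mono) auto
        finally have "norm (a n) * (\<Prod>j<n. r + (real j)\<^sup>2)
            \<le> A * (5 * r) powr ((4 * r) powr c)"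
          using A prod elim by (intro mult_mono) (auto intro: prod_nonneg order_trans)
        then show ?thesis
          using True by (simp add: add_increasing)
      next
        case False
        then have n: "(4 * r) powr c \<le> real n" "N \<le> n"
          using elim by auto
        have "4 * r = ((4 * r) powr c) powr (1 / c)"
          using elim assms by (simp add: powr_powr)
        also have "\<dots> \<le> real n powr (1 / c)"
          using n assms by (intro powr_mono2) auto
        finally have "real n powr (- 1 / c) * r \<le> 1 / 4"
          using n N(1) by (simp add: powr_minus_divide field_simps)
        then have "real n powr (- 1 / c) * (r + (real n)\<^sup>2) \<le> 1 / 2"
          using N(3)[OF n(2)] by (simp add: distrib_left)
        then have "(real n powr (- 1 / c) * (r + (real n)\<^sup>2)) ^ n \<le> (1 / 2) ^ n"
          using elim by (intro power_mono) auto
        moreover have "norm (a n) * (\<Prod>j<n. r + (real j)\<^sup>2)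
            \<le> (real n powr (- 1 / c)) ^ n * (r + (real n)\<^sup>2) ^ n"
          using N(2)[OF n(2)] prod elim by (intro mult_mono) (auto intro: prod_nonneg)
        ultimately show ?thesis
          using False by (simp add: power_mult_distrib)
      qed
    qed
  qed
  with A(1) show ?thesis
    by (rule that)
qed

text \<open>
  The preceding lemma is used with some \<open>c\<close> strictly between the limit superior and \<open>s\<close>; the gap absorbs
  the logarithm in \<open>(5 r) powr ((4 r)\<^sup>c) = exp ((4 r)\<^sup>c ln (5 r))\<close>, the constants and the number of terms.
  Bounding partial sums instead of the series makes a separate proof of summability superfluous.
\<close>

lemma eventually_wilson_sum_le:
  assumes "wilson_expansion f a" "0 < s" "s < 1 / 2"
    and "limsup (\<lambda>n. ereal (coeff_quotient a n)) < ereal s"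
  shows "eventually (\<lambda>r. \<forall>m. (\<Sum>n<m. norm (a n) * (\<Prod>j<n. r + (real j)\<^sup>2))
    \<le> exp (r powr s)) at_top"
proof -
  obtain w where w: "limsup (\<lambda>n. ereal (coeff_quotient a n)) < w" "w < ereal s"
    using dense[OF assms(4)] by blast
  then have "0 < w"
    using limsup_coeff_quotient_nonneg[OF assms(1)] by (metis order.strict_trans1)
  then obtain c where c: "w = ereal c" "0 < c" "c < s"
    using w by (cases w) auto
  define P where "P r = (4 * r) powr c" for r
  obtain A where A: "0 < A" "eventually (\<lambda>r. \<forall>n. norm (a n) * (\<Prod>j<n. r + (real j)\<^sup>2)
      \<le> (1 / 2) ^ n + (if real n < P r then A * (5 * r) powr P r else 0)) at_top"
    using eventually_wilson_term_le[OF assms(1), of c] c w assms(3) unfolding P_def by auto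
  have "eventually (\<lambda>r. 2 + (P r + 1) * (A * (5 * r) powr P r) \<le> exp (r powr s)) at_top"
  proof -
    define d where "d = s - c"
    have d: "0 < d" "s = c + d"
      using c by (auto simp: d_def)
    show ?thesis
      unfolding d(2) P_def using c(2) d(1) A(1) by real_asymp
  qed
  with A(2) show ?thesis
  proof eventually_elim
    case (elim r)
    show ?case
    proof
      fix m
      let ?D = "A * (5 * r) powr P r"
      have D: "0 \<le> ?D"
        using A(1) by simp
      have "(\<Sum>n<m. norm (a n) * (\<Prod>j<n. r + (real j)\<^sup>2))
          \<le> (\<Sum>n<m. (1 / 2) ^ n + (if real n < P r then ?D else 0))"
        using elim(1) by (intro sum_mono) blast
      also have "\<dots> = (\<Sum>n<m. (1 / 2) ^ n) + (\<Sum>n\<in>{n\<in>{..<m}. real n < P r}. ?D)"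
        by (simp add: sum.distrib sum.If_cases Int_def del: sum_constant)
      also have "(\<Sum>n<m. (1 / 2) ^ n) \<le> (2 :: real)"
        by (simp add: sum_gp_strict)
      also have "(\<Sum>n\<in>{n\<in>{..<m}. real n < P r}. ?D) \<le> (\<Sum>n<nat \<lceil>P r\<rceil>. ?D)"
        using D by (intro sum_mono2) (auto simp: less_ceiling_iff nat_less_iff zless_nat_eq_int_zless)
      also have "\<dots> \<le> (P r + 1) * ?D"
        using D by (auto intro!: mult_right_mono simp: P_def)
      also have "2 + (P r + 1) * ?D \<le> exp (r powr s)"
        by (rule elim)
      finally show "(\<Sum>n<m. norm (a n) * (\<Prod>j<n. r + (real j)\<^sup>2)) \<le> exp (r powr s)"
        by simp
    qed
  qed
qed

lemma norm_wilson_basis_le: "norm (wilson_basis n x) \<le> (\<Prod>j<n. norm x + (real j)\<^sup>2)"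
proof -
  have "norm (- (of_nat j)\<^sup>2 - x) \<le> norm x + (real j)\<^sup>2" for j
    using norm_triangle_ineq4[of "- (of_nat j)\<^sup>2" x] by (simp add: norm_power)
  then show ?thesis
    unfolding wilson_basis_def by (simp add: prod_norm[symmetric] prod_mono)
qed

lemma max_modulus_le:
  assumes "f holomorphic_on UNIV" "wilson_expansion f a" "0 \<le> r"
    and "\<And>m. (\<Sum>n<m. norm (a n) * (\<Prod>j<n. r + (real j)\<^sup>2)) \<le> E"
  shows "max_modulus f r \<le> E"
proof -
  obtain x where x: "norm x = r" "max_modulus f r = norm (f x)"
    using max_modulus_attained[OF assms(1,3)] by auto
  have "uniform_limit {x} (\<lambda>n x. \<Sum>k<n. a k * wilson_basis k x) f sequentially"
    using assms(2) compact_sing unfolding wilson_expansion_def by blast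
  then have "(\<lambda>n. norm (\<Sum>k<n. a k * wilson_basis k x)) \<longlonglongrightarrow> norm (f x)"
    by (simp add: tendsto_norm)
  moreover have "norm (\<Sum>k<n. a k * wilson_basis k x) \<le> E" for n
  proof -
    have "norm (\<Sum>k<n. a k * wilson_basis k x) \<le> (\<Sum>k<n. norm (a k * wilson_basis k x))"
      by (rule norm_sum)
    also have "\<dots> \<le> (\<Sum>k<n. norm (a k) * (\<Prod>j<k. r + (real j)\<^sup>2))"
      using norm_wilson_basis_le[of _ x]
      by (intro sum_mono) (auto simp: norm_mult x(1) intro!: mult_left_mono)
    finally show ?thesis
      using assms(4)[of n] by simp
  qed
  ultimately have "norm (f x) \<le> E"
    by (intro LIMSEQ_le_const2) auto
  then show ?thesis
    using x(2) by simp
qed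

lemma wilson_max_term_le:
  assumes "wilson_expansion f a" "0 \<le> r"
    and "\<And>m. (\<Sum>n<m. norm (a n) * (\<Prod>j<n. r + (real j)\<^sup>2)) \<le> E"
  shows "wilson_max_term a r \<le> E"
proof -
  obtain n where n: "wilson_max_term a r = norm (a n) * (\<Prod>j<n. r + (real j)\<^sup>2)"
    using wilson_max_term_attained[OF assms(1,2)] by auto
  also have "\<dots> \<le> (\<Sum>k<Suc n. norm (a k) * (\<Prod>j<k. r + (real j)\<^sup>2))"
    by (rule member_le_sum) (use assms(2) in \<open>auto intro!: mult_nonneg_nonneg prod_nonneg\<close>)
  also have "\<dots> \<le> E"
    by (rule assms(3))
  finally show ?thesis .
qed

lemma growth_orders_le_limsup_coeff_quotient:
  assumes "f holomorphic_on UNIV" "wilson_expansion f a"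
    and "limsup (\<lambda>n. ereal (coeff_quotient a n)) < ereal (1 / 2)"
  shows "entire_order f \<le> limsup (\<lambda>n. ereal (coeff_quotient a n))"
    and "growth_order (wilson_max_term a) \<le> limsup (\<lambda>n. ereal (coeff_quotient a n))"
proof -
  have "entire_order f \<le> w \<and> growth_order (wilson_max_term a) \<le> w"
    if w: "limsup (\<lambda>n. ereal (coeff_quotient a n)) < w" "w < ereal (1 / 2)" for w
  proof -
    have "0 < w"
      using limsup_coeff_quotient_nonneg[OF assms(2)] w(1) by (rule order.strict_trans1)
    then obtain s where s: "w = ereal s" "0 < s" "s < 1 / 2"
      using w(2) by (cases w) auto
    note sum_le = eventually_wilson_sum_le[OF assms(2) s(2,3) w(1)[unfolded s(1)]]
    have "eventually (\<lambda>r. max_modulus f r \<le> exp (r powr s)) at_top"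
      using sum_le eventually_ge_at_top[of 0]
      by eventually_elim (intro max_modulus_le[OF assms(1,2)], auto)
    moreover have "eventually (\<lambda>r. wilson_max_term a r \<le> exp (r powr s)) at_top"
      using sum_le eventually_ge_at_top[of 0]
      by eventually_elim (intro wilson_max_term_le[OF assms(2)], auto)
    ultimately show ?thesis
      unfolding s(1) entire_order_def using s(2) growth_order_le by blast
  qed
  then show "entire_order f \<le> limsup (\<lambda>n. ereal (coeff_quotient a n))"
    and "growth_order (wilson_max_term a) \<le> limsup (\<lambda>n. ereal (coeff_quotient a n))"
    by (auto intro: dense_ge_bounded[OF assms(3)])
qed

theorem theorem4p5:
  fixes f :: "complex \<Rightarrow> complex" and a :: "nat \<Rightarrow> complex"
  assumes "f holomorphic_on UNIV"
    and "\<exists>x. f x \<noteq> 0"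
    and "entire_order f < ereal (1 / 2)"
    and "wilson_expansion f a"
  shows "growth_order (wilson_max_term a) = limsup (\<lambda>n. ereal (coeff_quotient a n)) \<and>
    (entire_order f < ereal (1 / 3) \<longrightarrow>
       entire_order f = limsup (\<lambda>n. ereal (coeff_quotient a n)))"
proof -
  note le = limsup_coeff_quotient_le_entire_order[OF assms(1,4,3)]
  note ge = growth_orders_le_limsup_coeff_quotient[OF assms(1,4) order.strict_trans1[OF le assms(3)]]
  show ?thesis
    using le ge limsup_coeff_quotient_le_max_term_order[OF assms(4)] by (auto intro: antisym)
qed

end
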